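(* Consider the frontier automaton on the state set $\{-2,-1,0,1,2\}^2$, with states written $(\delta_+,\delta_-)$. The set of states reachable from the scalar initialization $(0,0)$ and the zigzag initializations $(\pm1,0),(0,\pm1)$ decomposes into two disjoint components, $\mathcal N=\{(0,0),(1,1),(-1,-1)\}$ and a set $\mathcal C$ of ten states, with no transition between them: walks started at the scalar initialization stay in $\mathcal N$ and walks started at the zigzag initializations stay in $\mathcal C$. In particular no transition leads from $\mathcal C$ into $\mathcal N$; the only states with a transition into $(0,0)$ are the three states of $\mathcal N$. The quantity $\delta_+-\delta_-\bmod 3$ separates the components: it is $0$ at every state of $\mathcal N$ and nonzero at every state of $\mathcal C$. The Perron roots (spectral radii of the transfer matrices, whose entries count transitions with multiplicity, restricted to the component) are $$\lambda_{\mathcal N}=\frac{7+\sqrt{33}}{2},\qquad \lambda_{\mathcal C}=3 .$$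
   Context: The automaton is defined as follows. For a level $j\ge 3$ there are formal nodes $+1,-1$ (semitone nodes), $\pm(j-1)$ (inner nodes) and $\pm j$ (outer nodes). There are six "low" edges: I: $+1\to+(j-1)$; II: $+j\to-(j-1)$; III: $-1\to+j$; IV: $+(j-1)\to-j$; V: $-j\to+1$; VI: $-(j-1)\to-1$; and six "high" edges: I: $+1\to-j$; II: $-(j-1)\to+j$; III: $-1\to-(j-1)$; IV: $-j\to+(j-1)$; V: $+(j-1)\to+1$; VI: $+j\to-1$. A state $(\delta_+,\delta_-)$ at level $j-1$ records the imbalance (out-degree minus in-degree) accumulated so far at the frontier nodes $+(j-1)$ and $-(j-1)$. A transition consists of a choice of one low edge and one high edge (36 combinations); it is allowed from $(\delta_+,\delta_-)$ exactly when adding these two edges makes both inner nodes $\pm(j-1)$ have total imbalance $0$, and it leads to the state $(\delta_+',\delta_-')$ given by the imbalance (out minus in) that the two edges produce at $+j$ and $-j$. Imbalances at the semitone nodes $\pm1$ are ignored. The rule does not depend on $j$; distinct combinations giving the same source and target count as distinct transitions. The ten states of $\mathcal C$ are $(-2,0),(-1,0),(-1,1),(0,-2),(0,-1),(0,1),(0,2),(1,-1),(1,0),(2,0)$. *)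

theory Defs
  imports "Jordan_Normal_Form.Spectral_Radius"
begin

text \<open>The formal nodes at a level \<open>j \<ge> 3\<close>: \<open>Semitone\<close>, \<open>Inner\<close>, \<open>Outer\<close> stand for
  \<open>\<plusminus>1\<close>, \<open>\<plusminus>(j - 1)\<close>, \<open>\<plusminus>j\<close>, respectively. The rule is the same at every level,
  so the level itself does not appear.\<close>

datatype pole = Plus | Minus

datatype node = Semitone pole | Inner pole | Outer pole

datatype edge_label = E_I | E_II | E_III | E_IV | E_V | E_VI

text \<open>A directed edge is a pair (tail, head).\<close>

type_synonym edge = "node \<times> node"

fun low_edge :: "edge_label \<Rightarrow> edge" where
  "low_edge E_I   = (Semitone Plus,  Inner Plus)"
| "low_edge E_II  = (Outer Plus,     Inner Minus)"
| "low_edge E_III = (Semitone Minus, Outer Plus)"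
| "low_edge E_IV  = (Inner Plus,     Outer Minus)"
| "low_edge E_V   = (Outer Minus,    Semitone Plus)"
| "low_edge E_VI  = (Inner Minus,    Semitone Minus)"

fun high_edge :: "edge_label \<Rightarrow> edge" where
  "high_edge E_I   = (Semitone Plus,  Outer Minus)"
| "high_edge E_II  = (Inner Minus,    Outer Plus)"
| "high_edge E_III = (Semitone Minus, Inner Minus)"
| "high_edge E_IV  = (Outer Minus,    Inner Plus)"
| "high_edge E_V   = (Inner Plus,     Semitone Plus)"
| "high_edge E_VI  = (Outer Plus,     Semitone Minus)"

definition edge_imbalance :: "edge \<Rightarrow> node \<Rightarrow> int" where
  "edge_imbalance e v = of_bool (fst e = v) - of_bool (snd e = v)"

text \<open>A choice \<open>(l, h)\<close> picks the low edge labelled \<open>l\<close> and the high edge labelled \<open>h\<close>.\<close>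

type_synonym choice = "edge_label \<times> edge_label"

definition imbalance :: "choice \<Rightarrow> node \<Rightarrow> int" where
  "imbalance c v = edge_imbalance (low_edge (fst c)) v + edge_imbalance (high_edge (snd c)) v"

type_synonym state = "int \<times> int"

definition states :: "state set" where
  "states = {-2..2} \<times> {-2..2}"

definition allowed :: "state \<Rightarrow> choice \<Rightarrow> bool" where
  "allowed s c \<longleftrightarrow>
     fst s + imbalance c (Inner Plus) = 0 \<and> snd s + imbalance c (Inner Minus) = 0"

definition target :: "choice \<Rightarrow> state" where
  "target c = (imbalance c (Outer Plus), imbalance c (Outer Minus))"

definition transitions :: "state \<Rightarrow> state \<Rightarrow> choice set" where
  "transitions s t = {c. allowed s c \<and> target c = t}"

definition step :: "(state \<times> state) set" where
  "step = {(s, t). transitions s t \<noteq> {}}"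

definition reachable :: "state set \<Rightarrow> state set" where
  "reachable S = step\<^sup>* `` S"

definition scalar_init :: state where
  "scalar_init = (0, 0)"

definition zigzag_inits :: "state set" where
  "zigzag_inits = {(1, 0), (-1, 0), (0, 1), (0, -1)}"

definition comp_N :: "state set" where
  "comp_N = {(0, 0), (1, 1), (-1, -1)}"

definition comp_C :: "state set" where
  "comp_C = {(-2, 0), (-1, 0), (-1, 1), (0, -2), (0, -1),
             (0, 1), (0, 2), (1, -1), (1, 0), (2, 0)}"

text \<open>The transfer matrix restricted to the set of states enumerated by \<open>xs\<close>.\<close>

definition transfer_matrix :: "state list \<Rightarrow> complex mat" where
  "transfer_matrix xs =
     mat (length xs) (length xs) (\<lambda>(i, k). of_nat (card (transitions (xs ! i) (xs ! k))))"

end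

theory Submission
  imports Defs
begin

text \<open>A choice of edges fixes both the source and the target of its transition, so the automaton
  is a list of 36 arrows, from which the components are read off. For the Perron roots,
  a nonnegative matrix with a strictly positive eigenvector has the eigenvalue of that vector as its
  spectral radius; on \<open>comp_N\<close> one takes \<open>(1, a, a)\<close> with \<open>2 a\<^sup>2 + 5 a = 1\<close>, and on \<open>comp_C\<close> the
  eigenvector has entries \<open>1\<close>, \<open>2\<close>, \<open>3\<close>.\<close>

section \<open>Spectral radius from a positive eigenvector\<close>

text \<open>\<open>v\<close> itself puts \<open>l\<close> into the spectrum. For the upper bound, an
  eigenvector \<open>w\<close> for any \<open>k\<close> is measured against \<open>v\<close>: in the
  row where \<open>norm (w $ i) / v $ i\<close> is largest, the triangle inequality and the row
  equation of \<open>v\<close> give \<open>norm k \<le> l\<close>.\<close>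

lemma spectral_radius_eq_of_positive_eigenvector:
  fixes A :: "real mat" and v :: "real vec" and l :: real
  assumes A: "A \<in> carrier_mat n n" and v: "v \<in> carrier_vec n" and n: "n > 0"
    and nonneg: "\<And>i j. i < n \<Longrightarrow> j < n \<Longrightarrow> A $$ (i, j) \<ge> 0"
    and pos: "\<And>i. i < n \<Longrightarrow> v $ i > 0"
    and eig: "A *\<^sub>v v = l \<cdot>\<^sub>v v"
  shows "spectral_radius (map_mat complex_of_real A) = l"
proof -
  let ?A = "map_mat complex_of_real A"
  have A': "?A \<in> carrier_mat n n" using A by simp
  have row: "(\<Sum>j<n. A $$ (i, j) * v $ j) = l * v $ i" if "i < n" for i
  proof -
    have "(A *\<^sub>v v) $ i = (\<Sum>j<n. A $$ (i, j) * v $ j)"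
      using A v that by (auto simp: scalar_prod_def lessThan_atLeast0 intro!: sum.cong)
    then show ?thesis using eig v that by simp
  qed
  \<comment> \<open>The sign of \<open>l\<close> matters at the end, where the norm of
    \<open>complex_of_real l\<close> must be \<open>l\<close> itself.\<close>
  have "0 \<le> l * v $ 0"
    unfolding row[OF n, symmetric] using nonneg[OF n] pos by (intro sum_nonneg) (simp add: less_imp_le)
  then have l0: "l \<ge> 0" using pos[OF n] by (simp add: zero_le_mult_iff)
  have upper: "norm k \<le> l" if "k \<in> spectrum ?A" for k
  proof -
    from that obtain w where w: "w \<in> carrier_vec n" "w \<noteq> 0\<^sub>v n" "?A *\<^sub>v w = k \<cdot>\<^sub>v w"
      using A by (auto simp: spectrum_def eigenvalue_def eigenvector_def)
    \<comment> \<open>\<open>r\<close> is the sup norm of \<open>w\<close> weighted by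
      \<open>v\<close>; the row \<open>i\<close> attaining it is the one to estimate.\<close>
    define q where "q i = norm (w $ i) / v $ i" for i
    define r where "r = Max (q ` {..<n})"
    have "r \<in> q ` {..<n}" unfolding r_def using n by (intro Max_in) auto
    then obtain i where i: "i < n" "r = q i" by auto
    have qr: "q j \<le> r" if "j < n" for j unfolding r_def using that by simp
    have wr: "norm (w $ j) \<le> r * v $ j" if "j < n" for j
      using qr[OF that] pos[OF that] by (simp add: q_def divide_le_eq)
    have wi: "norm (w $ i) = r * v $ i" using i pos[OF i(1)] by (simp add: q_def)
    \<comment> \<open>A nonzero entry makes \<open>r\<close> positive, so that
      \<open>norm (w $ i) = r * v $ i\<close> can be cancelled in the final inequality.\<close>
    from w(1,2) obtain j where j: "j < n" "w $ j \<noteq> 0" by (metis eq_vecI carrier_vecD index_zero_vec)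
    have "0 < q j" using j pos by (simp add: q_def)
    then have r0: "r > 0" using qr[OF j(1)] by simp
    have "k * w $ i = (?A *\<^sub>v w) $ i" using w i by simp
    also have "\<dots> = (\<Sum>j<n. A $$ (i, j) * w $ j)"
      using A w(1) i by (auto simp: scalar_prod_def lessThan_atLeast0 intro!: sum.cong)
    finally have "norm k * norm (w $ i) = norm (\<Sum>j<n. A $$ (i, j) * w $ j)"
      by (metis norm_mult)
    also have "\<dots> \<le> (\<Sum>j<n. A $$ (i, j) * (r * v $ j))"
      using nonneg[OF i(1)] wr by (intro sum_norm_le) (simp add: norm_mult mult_left_mono)
    also have "\<dots> = r * (\<Sum>j<n. A $$ (i, j) * v $ j)"
      by (simp add: sum_distrib_left mult_ac)
    also have "\<dots> = l * norm (w $ i)" by (simp add: row[OF i(1)] wi)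
    finally show ?thesis using r0 pos[OF i(1)] by (simp add: wi)
  qed
  have "?A *\<^sub>v map_vec complex_of_real v = complex_of_real l \<cdot>\<^sub>v map_vec complex_of_real v"
    by (metis A eig of_real_hom.mult_mat_vec_hom of_real_hom.vec_hom_smult v)
  moreover have "map_vec complex_of_real v \<noteq> 0\<^sub>v n"
  proof
    assume "map_vec complex_of_real v = 0\<^sub>v n"
    then have "map_vec complex_of_real v $ 0 = 0" using n by simp
    then show False using pos[OF n] v n by simp
  qed
  ultimately have "complex_of_real l \<in> spectrum ?A"
    using A v by (auto simp: spectrum_def eigenvalue_def eigenvector_def intro!: exI[of _ "map_vec complex_of_real v"])
  then have "norm (complex_of_real l) \<le> spectral_radius ?A"
    by (intro spectral_radius_mem_max(2)[OF A' n] imageI)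
  then have "l \<le> spectral_radius ?A" using l0 by simp
  moreover have "spectral_radius ?A \<le> l"
    using spectral_radius_mem_max(1)[OF A' n] upper by auto
  ultimately show ?thesis by simp
qed

text \<open>Indexing the eigenvector by states instead of positions makes the eigenvalue equation
  independent of the enumeration \<open>xs\<close>; distinctness makes \<open>nth\<close> a
  bijection from positions to states.\<close>

lemma spectral_radius_transfer_matrix:
  fixes v :: "state \<Rightarrow> real"
  assumes xs: "distinct xs" "xs \<noteq> []"
    and pos: "\<And>s. s \<in> set xs \<Longrightarrow> v s > 0"
    and eig: "\<And>s. s \<in> set xs \<Longrightarrow> (\<Sum>t\<in>set xs. real (card (transitions s t)) * v t) = l * v s"
  shows "spectral_radius (transfer_matrix xs) = l"
proof -
  let ?n = "length xs"
  define A where "A = mat ?n ?n (\<lambda>(i, k). real (card (transitions (xs ! i) (xs ! k))))"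
  define u where "u = vec ?n (\<lambda>i. v (xs ! i))"
  have "A *\<^sub>v u = l \<cdot>\<^sub>v u"
  proof (rule eq_vecI)
    fix i assume "i < dim_vec (l \<cdot>\<^sub>v u)"
    then have i: "i < ?n" by (simp add: u_def)
    have "(A *\<^sub>v u) $ i = (\<Sum>j<?n. real (card (transitions (xs ! i) (xs ! j))) * v (xs ! j))"
      using i by (auto simp: A_def u_def scalar_prod_def lessThan_atLeast0 intro!: sum.cong)
    also have "\<dots> = (\<Sum>t\<in>set xs. real (card (transitions (xs ! i) t)) * v t)"
      by (rule sum.reindex_bij_betw[OF bij_betw_nth]) (use xs in auto)
    finally show "(A *\<^sub>v u) $ i = (l \<cdot>\<^sub>v u) $ i" using i eig by (simp add: u_def)
  qed (simp add: A_def u_def)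
  moreover have "transfer_matrix xs = map_mat complex_of_real A"
    by (rule eq_matI) (auto simp: A_def transfer_matrix_def)
  ultimately show ?thesis
    using spectral_radius_eq_of_positive_eigenvector[of A ?n u l] xs pos
    by (simp add: A_def u_def)
qed

section \<open>The automaton as a list of arrows\<close>

definition labels :: "edge_label list" where
  "labels = [E_I, E_II, E_III, E_IV, E_V, E_VI]"

text \<open>The inner nodes must balance to 0, so the only source allowing \<open>c\<close> is the
  negated inner imbalance.\<close>

definition arrow :: "choice \<Rightarrow> state \<times> state" where
  "arrow c = ((- imbalance c (Inner Plus), - imbalance c (Inner Minus)), target c)"

text \<open>A list keeps parallel transitions apart, as the transfer matrix requires.\<close>

definition arrows :: "(state \<times> state) list" where
  "arrows = map arrow (List.product labels labels)"

lemma set_labels: "set labels = UNIV"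
  by (auto simp: labels_def intro: edge_label.exhaust)

lemma arrow_in_arrows: "arrow c \<in> set arrows"
  by (cases c) (auto simp: arrows_def set_labels)

lemma transitions_conv_arrow: "transitions s t = {c. arrow c = (s, t)}"
  by (cases s) (auto simp: transitions_def allowed_def arrow_def)

lemma step_conv_arrows: "step = set arrows"
proof -
  have "(s, t) \<in> step \<longleftrightarrow> (\<exists>c. arrow c = (s, t))" for s t
    by (simp add: step_def transitions_conv_arrow)
  moreover have "set arrows = range arrow" by (simp add: arrows_def set_labels)
  ultimately show ?thesis by (auto simp del: split_paired_Ex simp: image_iff) metis+
qed

text \<open>The product list contains every choice exactly once, so repetitions of an arrow
  correspond to distinct choices.\<close>

lemma card_transitions: "card (transitions s t) = count_list arrows (s, t)"
proof -
  have "distinct (List.product labels labels)"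
    by (intro distinct_product) (simp_all add: labels_def)
  from distinct_length_filter[OF this, of "\<lambda>c. (s, t) = arrow c"]
  have "length (filter (\<lambda>c. (s, t) = arrow c) (List.product labels labels)) =
      card {c. (s, t) = arrow c}"
    by (simp add: set_labels)
  moreover have "count_list arrows (s, t) =
      length (filter (\<lambda>c. (s, t) = arrow c) (List.product labels labels))"
    unfolding arrows_def count_list_eq_length_filter filter_map length_map comp_def ..
  ultimately show ?thesis by (simp add: transitions_conv_arrow eq_commute[of "arrow _"])
qed

text \<open>Every two printed rows belong to one low edge, with the high edge running from I to
  VI.\<close>

lemma arrows_eq: "arrows = [
    ((1, 0), (0, -1)), ((1, -1), (-1, 0)), ((1, 1), (0, 0)),
    ((2, 0), (0, 1)), ((0, 0), (0, 0)), ((1, 0), (1, 0)),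
    ((0, 1), (1, -1)), ((0, 0), (0, 0)), ((0, 2), (1, 0)),
    ((1, 1), (1, 1)), ((-1, 1), (1, 0)), ((0, 1), (2, 0)),
    ((0, 0), (-1, -1)), ((0, -1), (-2, 0)), ((0, 1), (-1, 0)),
    ((1, 0), (-1, 1)), ((-1, 0), (-1, 0)), ((0, 0), (0, 0)),
    ((-1, 0), (0, -2)), ((-1, -1), (-1, -1)), ((-1, 1), (0, -1)),
    ((0, 0), (0, 0)), ((-2, 0), (0, -1)), ((-1, 0), (1, -1)),
    ((0, 0), (0, 0)), ((0, -1), (-1, 1)), ((0, 1), (0, 1)),
    ((1, 0), (0, 2)), ((-1, 0), (0, 1)), ((0, 0), (1, 1)),
    ((0, -1), (0, -1)), ((0, -2), (-1, 0)), ((0, 0), (0, 0)),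
    ((1, -1), (0, 1)), ((-1, -1), (0, 0)), ((0, -1), (1, 0))]"
  by (simp add: arrows_def labels_def arrow_def target_def imbalance_def edge_imbalance_def)

section \<open>Reachability and the two components\<close>

lemma reachable_subset_closed:
  assumes "S \<subseteq> X" and "step `` X \<subseteq> X"
  shows "reachable S \<subseteq> X"
  unfolding reachable_def using assms by (metis Image_closed_trancl Image_mono subset_refl)

text \<open>Paths of length at most one suffice as a lower bound: every state of either component is
  one of its initializations or a single step away from one.\<close>

lemma subset_reachable: "S \<union> step `` S \<subseteq> reachable S"
  by (auto simp: reachable_def)

lemma reachable_Un: "reachable (S \<union> T) = reachable S \<union> reachable T"
  by (auto simp: reachable_def)

text \<open>Conceptually, each low edge shifts \<delta>_+ - \<delta>_- by -1 modulo 3 and each high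
  edge by +1, so a transition preserves the residue. The closure itself is checked on the
  arrows.\<close>

lemma step_comp_N: "step `` comp_N \<subseteq> comp_N"
proof -
  have "\<forall>(s, t)\<in>set arrows. s \<in> comp_N \<longrightarrow> t \<in> comp_N"
    by (simp add: arrows_eq comp_N_def)
  then show ?thesis by (auto simp: step_conv_arrows)
qed

lemma step_comp_C: "step `` comp_C \<subseteq> comp_C"
proof -
  have "\<forall>(s, t)\<in>set arrows. s \<in> comp_C \<longrightarrow> t \<in> comp_C"
    by (simp add: arrows_eq comp_C_def)
  then show ?thesis by (auto simp: step_conv_arrows)
qed

lemma finite_comp_N: "finite comp_N" and finite_comp_C: "finite comp_C"
  by (simp_all add: comp_N_def comp_C_def)

lemma comp_disjoint: "comp_N \<inter> comp_C = {}"
  by (auto simp: comp_N_def comp_C_def)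

lemma reachable_scalar_init: "reachable {scalar_init} = comp_N"
proof
  show "reachable {scalar_init} \<subseteq> comp_N"
    by (rule reachable_subset_closed[OF _ step_comp_N]) (simp add: scalar_init_def comp_N_def)
  have "comp_N \<subseteq> {scalar_init} \<union> step `` {scalar_init}"
    by (simp add: Image_iff step_conv_arrows arrows_eq comp_N_def scalar_init_def)
  then show "comp_N \<subseteq> reachable {scalar_init}" using subset_reachable by blast
qed

lemma reachable_zigzag_inits: "reachable zigzag_inits = comp_C"
proof
  show "reachable zigzag_inits \<subseteq> comp_C"
    by (rule reachable_subset_closed[OF _ step_comp_C]) (simp add: zigzag_inits_def comp_C_def)
  have "comp_C \<subseteq> zigzag_inits \<union> step `` zigzag_inits"
    by (simp add: Image_iff step_conv_arrows arrows_eq comp_C_def zigzag_inits_def)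
  then show "comp_C \<subseteq> reachable zigzag_inits" using subset_reachable by blast
qed

lemma target_in_states: "target c \<in> states"
proof -
  have "\<forall>(s, t) \<in> set arrows. t \<in> states" by (simp add: arrows_eq states_def)
  then show ?thesis using arrow_in_arrows[of c] by (auto simp: arrow_def)
qed

section \<open>Perron roots of the components\<close>

text \<open>This turns a row of the eigenvalue equation into one pass over the list, which
  simplification can evaluate.\<close>

lemma sum_count_list:
  fixes v :: "'b \<Rightarrow> real"
  assumes "finite X" and "\<forall>t. (s, t) \<in> set es \<longrightarrow> t \<in> X"
  shows "(\<Sum>t\<in>X. real (count_list es (s, t)) * v t) = (\<Sum>e\<leftarrow>es. if fst e = s then v (snd e) else 0)"
  using assms(2)
proof (induction es)
  case (Cons e es)
  \<comment> \<open>The test \<open>snd e = t\<close> stands outermost to match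
    \<open>sum.delta'\<close>; the resulting condition \<open>snd e \<in> X\<close> holds by
    hypothesis whenever \<open>fst e = s\<close>.\<close>
  have "(\<Sum>t\<in>X. real (count_list (e # es) (s, t)) * v t) =
      (\<Sum>t\<in>X. real (count_list es (s, t)) * v t + (if snd e = t then if fst e = s then v t else 0 else 0))"
    by (intro sum.cong) (auto simp: algebra_simps prod_eq_iff)
  also have "\<dots> = (\<Sum>t\<in>X. real (count_list es (s, t)) * v t) +
      (if snd e \<in> X then if fst e = s then v (snd e) else 0 else 0)"
    unfolding sum.distrib by (simp only: sum.delta'[OF assms(1)])
  also have "\<dots> = (\<Sum>e\<leftarrow>e # es. if fst e = s then v (snd e) else 0)"
    using Cons by (cases e) auto
  finally show ?case .
qed simp

text \<open>Since \<open>X\<close> is closed under \<open>step\<close>, no arrow out of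
  \<open>s\<close> is lost by summing over \<open>X\<close> only.\<close>

lemma sum_transitions:
  fixes v :: "state \<Rightarrow> real"
  assumes "finite X" "step `` X \<subseteq> X" "s \<in> X"
  shows "(\<Sum>t\<in>X. real (card (transitions s t)) * v t) =
    (\<Sum>e\<leftarrow>arrows. if fst e = s then v (snd e) else 0)"
  unfolding card_transitions
  by (rule sum_count_list) (use assms in \<open>auto simp: step_conv_arrows\<close>)

lemma spectral_radius_comp_N:
  assumes "distinct xs" "set xs = comp_N"
  shows "spectral_radius (transfer_matrix xs) = (7 + sqrt 33) / 2"
proof -
  define a where "a = (sqrt 33 - 5) / 4"
  define l where "l = (7 + sqrt 33) / 2"
  define v where "v s = (if s = (0, 0) then 1 else a)" for s :: state
  have "sqrt 33 > 5" by (rule real_less_rsqrt) simp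
  then have "a > 0" by (simp add: a_def)
  \<comment> \<open>The state (0,0) has six loops and one arrow to each of (1,1) and (-1,-1); each
    of these has one loop and one arrow back. Eliminating \<open>l\<close> gives the quadratic whose
    positive root is \<open>a\<close>.\<close>
  have root: "6 + 2 * a = l" "1 + a = l * a"
    by (simp_all add: a_def l_def field_simps)
  have "\<forall>s\<in>comp_N. (\<Sum>e\<leftarrow>arrows. if fst e = s then v (snd e) else 0) = l * v s"
    using root by (simp add: comp_N_def arrows_eq v_def)
  then have eig: "(\<Sum>t\<in>comp_N. real (card (transitions s t)) * v t) = l * v s" if "s \<in> comp_N" for s
    using that by (simp add: sum_transitions[OF finite_comp_N step_comp_N])
  have "spectral_radius (transfer_matrix xs) = l"
  proof (rule spectral_radius_transfer_matrix[where v = v])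
    show "xs \<noteq> []" using assms(2) by (auto simp: comp_N_def)
    show "v s > 0" for s using \<open>a > 0\<close> by (simp add: v_def)
    show "(\<Sum>t\<in>set xs. real (card (transitions s t)) * v t) = l * v s" if "s \<in> set xs" for s
      using eig[of s] that unfolding assms(2) .
  qed (fact assms(1))
  then show ?thesis by (simp add: l_def)
qed

lemma spectral_radius_comp_C:
  assumes "distinct xs" "set xs = comp_C"
  shows "spectral_radius (transfer_matrix xs) = 3"
proof -
  \<comment> \<open>A zigzag state has arrows to two zigzag states, one state of weight 2 and one of
    weight 1: 3+3+2+1 = 9. A state of weight 2 has two arrows to zigzag states, one of weight 1 a
    single such arrow. Each row sum is thus three times the weight.\<close>
  define v :: "state \<Rightarrow> real" where
    "v s = (if s \<in> {(-1, 1), (1, -1)} then 2 else if s \<in> zigzag_inits then 3 else 1)" for s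
  have "\<forall>s\<in>comp_C. (\<Sum>e\<leftarrow>arrows. if fst e = s then v (snd e) else 0) = 3 * v s"
    by (simp add: comp_C_def arrows_eq v_def zigzag_inits_def)
  then have eig: "(\<Sum>t\<in>comp_C. real (card (transitions s t)) * v t) = 3 * v s" if "s \<in> comp_C" for s
    using that by (simp add: sum_transitions[OF finite_comp_C step_comp_C])
  show ?thesis
  proof (rule spectral_radius_transfer_matrix[where v = v])
    show "xs \<noteq> []" using assms(2) by (auto simp: comp_C_def)
    show "v s > 0" for s by (simp add: v_def)
    show "(\<Sum>t\<in>set xs. real (card (transitions s t)) * v t) = 3 * v s"
      if "s \<in> set xs" for s
      using eig[of s] that unfolding assms(2) .
  qed (fact assms(1))
qed

theorem theorem9p1:
  shows
    "(\<forall>s\<in>states. \<forall>c. allowed s c \<longrightarrow> target c \<in> states) \<and>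
     reachable (insert scalar_init zigzag_inits) = comp_N \<union> comp_C \<and>
     comp_N \<subseteq> states \<and> comp_C \<subseteq> states \<and>
     comp_N \<inter> comp_C = {} \<and>
     card comp_C = 10 \<and>
     (\<forall>s\<in>comp_N. \<forall>t\<in>comp_C. (s, t) \<notin> step \<and> (t, s) \<notin> step) \<and>
     reachable {scalar_init} = comp_N \<and>
     reachable zigzag_inits = comp_C \<and>
     {s \<in> states. (s, (0, 0)) \<in> step} = comp_N \<and>
     (\<forall>(p, m)\<in>comp_N. (p - m) mod 3 = 0) \<and>
     (\<forall>(p, m)\<in>comp_C. (p - m) mod 3 \<noteq> 0) \<and>
     (\<forall>xs. distinct xs \<and> set xs = comp_N \<longrightarrow>
        spectral_radius (transfer_matrix xs) = (7 + sqrt 33) / 2) \<and>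
     (\<forall>xs. distinct xs \<and> set xs = comp_C \<longrightarrow>
        spectral_radius (transfer_matrix xs) = 3)"
proof -
  have reach: "reachable (insert scalar_init zigzag_inits) = comp_N \<union> comp_C"
    using reachable_Un[of "{scalar_init}" zigzag_inits]
    by (simp add: reachable_scalar_init reachable_zigzag_inits)
  have sub: "comp_N \<subseteq> states" "comp_C \<subseteq> states"
    by (simp_all add: comp_N_def comp_C_def states_def)
  have card: "card comp_C = 10" by (simp add: comp_C_def)
  have sep: "\<forall>s\<in>comp_N. \<forall>t\<in>comp_C. (s, t) \<notin> step \<and> (t, s) \<notin> step"
    using step_comp_N step_comp_C comp_disjoint by blast
  have zero: "{s \<in> states. (s, (0, 0)) \<in> step} = comp_N"
  proof -
    \<comment> \<open>Closure of \<open>comp_C\<close> says nothing about sources outside both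
      components, so all arrows into (0,0) are inspected.\<close>
    have "\<forall>(s, t)\<in>set arrows. t = (0, 0) \<longrightarrow> s \<in> comp_N"
      by (simp add: arrows_eq comp_N_def)
    moreover have "\<forall>s\<in>comp_N. (s, (0, 0)) \<in> set arrows"
      by (simp add: arrows_eq comp_N_def)
    ultimately show ?thesis using sub(1) by (auto simp: step_conv_arrows)
  qed
  have mod3: "\<forall>(p, m)\<in>comp_N. (p - m) mod 3 = 0" "\<forall>(p, m)\<in>comp_C. (p - m) mod 3 \<noteq> 0"
    by (simp_all add: comp_N_def comp_C_def)
  have tgt: "\<forall>s\<in>states. \<forall>c. allowed s c \<longrightarrow> target c \<in> states"
    by (simp add: target_in_states)
  have radN: "\<forall>xs. distinct xs \<and> set xs = comp_N \<longrightarrow>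
      spectral_radius (transfer_matrix xs) = (7 + sqrt 33) / 2"
    using spectral_radius_comp_N by blast
  have radC: "\<forall>xs. distinct xs \<and> set xs = comp_C \<longrightarrow> spectral_radius (transfer_matrix xs) = 3"
    using spectral_radius_comp_C by blast
  show ?thesis
    by (intro conjI tgt reach sub card sep zero mod3 comp_disjoint
        reachable_scalar_init reachable_zigzag_inits radN radC)
qed

end
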